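(* Let $\mathfrak{G}=\langle a,b\mid (a^2)^b=a^{-2},\,(b^2)^a=b^{-2}\rangle$, and put $c=ab$, $x=a^2$, $y=b^2$, $z=c^2$. Fix a prime $d$ and integers $t,w$. Let $u=u_{t,w}\in\mathbb{F}_d[\mathfrak{G}]$ be the nontrivial unit corresponding to the parameters $t$ and $w$, and let $u_0=u_{0,0}$ be the one corresponding to $t=0$, $w=0$ (both as defined in the context). Then there is a group endomorphism $\sigma\colon\mathfrak{G}\to\mathfrak{G}$ given by $a\mapsto z^{w}z^{-t}a$ and $b\mapsto z^{w}b$, and, denoting also by $\sigma$ the $\mathbb{F}_d$-algebra endomorphism of $\mathbb{F}_d[\mathfrak{G}]$ it determines, \[ u=z^{t}\,\sigma(u_0).\]
   Context: Here $g^k=k^{-1}gk$ and $\mathbb{F}_d=\mathrm{GF}(d)$, $d$ prime. The group $\mathfrak{G}$ is torsion-free, and the subgroup $\mathfrak{H}=\langle x,y,z\rangle$ is normal of index 4 in $\mathfrak{G}$ and free abelian on $x=a^2$, $y=b^2$, $z=c^2$, where $c=ab$; the elements $1,a,b,c$ are coset representatives of $\mathfrak{H}$ in $\mathfrak{G}$. For integers $t,w$ define the following elements of $\mathbb{F}_d[\mathfrak{H}]$: \[ h=(1-z^{1-2t})^{d-2},\] \[ p=(1+x)(1+y)(z^t+z^{1-t})h,\] \[ q=z^w[(1+x)(x^{-1}+y^{-1})+(1+y^{-1})(1+z^{2t-1})]h,\] \[ r=z^w[(1+y^{-1})(x+y)z^t+(1+x)(z^t+z^{1-t})]h,\] \[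 s=z^{2t-1}+(4+x+x^{-1}+y+y^{-1})h,\] (for $d=2$, $h=1$), and set $u_{t,w}=p+qa+rb+sc\in\mathbb{F}_d[\mathfrak{G}]$. It is a known result of Murray that each $u_{t,w}$ is a nontrivial unit of $\mathbb{F}_d[\mathfrak{G}]$, i.e. a unit that is not a scalar multiple of an element of $\mathfrak{G}$. In particular, for $t=w=0$, $u_0=p_0+q_0a+r_0b+s_0ab$ with $h_0=(1-z)^{d-2}$, $p_0=(1+x)(1+y)(1+z)h_0$, $q_0=[(1+x)(x^{-1}+y^{-1})+(1+y^{-1})(1+z^{-1})]h_0$, $r_0=[(1+y^{-1})(x+y)+(1+x)(1+z)]h_0$, $s_0=z^{-1}+(4+x+x^{-1}+y+y^{-1})h_0$. *)

theory Defs
  imports Complex_Main "HOL-Computational_Algebra.Primes" "HOL-Library.Poly_Mapping"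
begin

section \<open>Groups given by generators and relations\<close>

text \<open>A letter \<open>(g, True)\<close> stands for the generator \<open>g\<close> and \<open>(g, False)\<close> for its formal inverse.\<close>

type_synonym 'g word = "('g \<times> bool) list"

definition word_inv :: "'g word \<Rightarrow> 'g word" where
  "word_inv v = rev (map (\<lambda>(g, e). (g, \<not> e)) v)"

text \<open>
  The group presented by relations \<open>v = w\<close> for \<open>(v, w) \<in> R\<close> consists of the words modulo the
  least congruence that contains \<open>R\<close> and cancels adjacent inverse letters.
\<close>

inductive pres_eq :: "('g word \<times> 'g word) set \<Rightarrow> 'g word \<Rightarrow> 'g word \<Rightarrow> bool"
  for R :: "('g word \<times> 'g word) set" where
  refl: "pres_eq R v v"
| sym: "pres_eq R v w \<Longrightarrow> pres_eq R w v"
| trans: "pres_eq R u v \<Longrightarrow> pres_eq R v w \<Longrightarrow> pres_eq R u w"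
| append: "pres_eq R v v' \<Longrightarrow> pres_eq R w w' \<Longrightarrow> pres_eq R (v @ w) (v' @ w')"
| cancel: "pres_eq R [(g, e), (g, \<not> e)] []"
| relation: "(v, w) \<in> R \<Longrightarrow> pres_eq R v w"

lemma equivp_pres_eq: "equivp (pres_eq R)"
  by (intro equivpI reflpI sympI transpI) (blast intro: pres_eq.intros)+

lemma word_inv_append: "word_inv (v @ w) = word_inv w @ word_inv v"
  by (simp add: word_inv_def)

lemma word_inv_word_inv: "word_inv (word_inv v) = v"
  by (induction v) (auto simp: word_inv_def rev_map)

lemma pres_eq_word_inv_left: "pres_eq R (word_inv v @ v) []"
proof (induction v)
  case Nil
  show ?case by (simp add: word_inv_def pres_eq.refl)
next
  case (Cons l v)
  obtain g e where l: "l = (g, e)" by (cases l)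
  have "pres_eq R ([(g, \<not> e), (g, e)] @ v) ([] @ v)"
    using pres_eq.cancel[of R g "\<not> e"] by (intro pres_eq.append pres_eq.refl) simp
  then have "pres_eq R (word_inv v @ ([(g, \<not> e), (g, e)] @ v)) (word_inv v @ v)"
    by (intro pres_eq.append pres_eq.refl) simp
  then show ?case
    using Cons.IH by (auto simp: l word_inv_def intro: pres_eq.trans)
qed

lemma pres_eq_word_inv_right: "pres_eq R (v @ word_inv v) []"
  using pres_eq_word_inv_left[of R "word_inv v"] by (simp add: word_inv_word_inv)

lemma pres_eq_word_inv_cong:
  assumes "pres_eq R v w"
  shows "pres_eq R (word_inv v) (word_inv w)"
proof -
  have "pres_eq R (word_inv v @ w @ word_inv w) (word_inv v @ [])"
    by (intro pres_eq.append pres_eq.refl pres_eq_word_inv_right)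
  moreover have "pres_eq R (word_inv v @ w @ word_inv w) (word_inv v @ v @ word_inv w)"
    by (intro pres_eq.append pres_eq.refl pres_eq.sym[OF assms])
  moreover have "pres_eq R ((word_inv v @ v) @ word_inv w) ([] @ word_inv w)"
    by (intro pres_eq.append pres_eq.refl pres_eq_word_inv_left)
  ultimately show ?thesis
    by simp (meson pres_eq.sym pres_eq.trans)
qed


section \<open>The group\<close>

datatype gen = A | B

text \<open>
  The relations \<open>(a\<^sup>2)\<^sup>b = a\<^sup>-\<^sup>2\<close> and \<open>(b\<^sup>2)\<^sup>a = b\<^sup>-\<^sup>2\<close>, where \<open>g\<^sup>k = k\<^sup>-\<^sup>1 g k\<close>.
\<close>

definition promislow_rels :: "(gen word \<times> gen word) set" where
  "promislow_rels =
    {([(B, False), (A, True), (A, True), (B, True)], [(A, False), (A, False)]),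
     ([(A, False), (B, True), (B, True), (A, True)], [(B, False), (B, False)])}"

quotient_type promislow = "gen word" / "pres_eq promislow_rels"
  by (rule equivp_pres_eq)

text \<open>
  The group is written multiplicatively, so that \<open>powi\<close> is exponentiation by integers.
  Since the convolution product of \<^typ>\<open>'a \<Rightarrow>\<^sub>0 'b\<close> is defined for additive monoids
  \<^typ>\<open>'a::monoid_add\<close>, the same operation is also made available as \<open>+\<close>, with neutral
  element \<open>0 = 1\<close>.
\<close>

instantiation promislow :: "{monoid_mult, inverse}"
begin

lift_definition one_promislow :: promislow is "[]" .

lift_definition times_promislow :: "promislow \<Rightarrow> promislow \<Rightarrow> promislow" is "(@)"
  by (rule pres_eq.append)

lift_definition inverse_promislow :: "promislow \<Rightarrow> promislow" is word_inv
  by (rule pres_eq_word_inv_cong)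

definition divide_promislow :: "promislow \<Rightarrow> promislow \<Rightarrow> promislow" where
  "divide_promislow g k = g * inverse k"

instance
  by standard (transfer, simp add: pres_eq.refl)+

end

lemma promislow_left_inverse: "inverse g * g = (1 :: promislow)"
  by transfer (rule pres_eq_word_inv_left)

lemma promislow_right_inverse: "g * inverse g = (1 :: promislow)"
  by transfer (rule pres_eq_word_inv_right)

instantiation promislow :: group_add
begin

definition zero_promislow :: promislow where "zero_promislow = 1"
definition plus_promislow :: "promislow \<Rightarrow> promislow \<Rightarrow> promislow" where
  "plus_promislow g k = g * k"
definition uminus_promislow :: "promislow \<Rightarrow> promislow" where
  "uminus_promislow g = inverse g"
definition minus_promislow :: "promislow \<Rightarrow> promislow \<Rightarrow> promislow" where
  "minus_promislow g k = g * inverse k"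

instance
  by standard
    (simp_all add: zero_promislow_def plus_promislow_def uminus_promislow_def
      minus_promislow_def mult.assoc promislow_left_inverse)

end

lift_definition pa :: promislow is "[(A, True)]" .
lift_definition pb :: promislow is "[(B, True)]" .

definition pc :: promislow where "pc = pa * pb"
definition px :: promislow where "px = pa ^ 2"
definition py :: promislow where "py = pb ^ 2"
definition pz :: promislow where "pz = pc ^ 2"

lemma promislow_relation_a: "inverse pb * pa ^ 2 * pb = pa powi (- 2)"
proof -
  have "inverse pb * (pa * pa) * pb = inverse pa * inverse pa"
    by transfer (auto simp: word_inv_def promislow_rels_def intro: pres_eq.relation)
  then show ?thesis by (simp add: power_int_def power2_eq_square)
qed

lemma promislow_relation_b: "inverse pa * pb ^ 2 * pa = pb powi (- 2)"
proof -
  have "inverse pa * (pb * pb) * pa = inverse pb * inverse pb"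
    by transfer (auto simp: word_inv_def promislow_rels_def intro: pres_eq.relation)
  then show ?thesis by (simp add: power_int_def power2_eq_square)
qed


section \<open>The group algebra\<close>

type_synonym 'f galg = "promislow \<Rightarrow>\<^sub>0 'f"

abbreviation gel :: "promislow \<Rightarrow> 'f::field galg" where
  "gel g \<equiv> Poly_Mapping.single g 1"

text \<open>The linear extension to the group algebra of a map of the group into itself.\<close>

definition galg_ext :: "(promislow \<Rightarrow> promislow) \<Rightarrow> 'f::field galg \<Rightarrow> 'f galg" where
  "galg_ext \<sigma> u =
    (\<Sum>g\<in>Poly_Mapping.keys u. Poly_Mapping.single (\<sigma> g) (Poly_Mapping.lookup u g))"

lemma galg_ext_superset:
  assumes "finite S" "Poly_Mapping.keys u \<subseteq> S"
  shows "galg_ext \<sigma> u =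
    (\<Sum>g\<in>S. Poly_Mapping.single (\<sigma> g) (Poly_Mapping.lookup u g))"
  unfolding galg_ext_def using assms
  by (intro sum.mono_neutral_left) (auto simp: in_keys_iff)

lemma galg_ext_single:
  "galg_ext \<sigma> (Poly_Mapping.single g k) = Poly_Mapping.single (\<sigma> g) k"
  by (subst galg_ext_superset[of "{g}"]) auto

lemma galg_ext_add: "galg_ext \<sigma> (u + v) = galg_ext \<sigma> u + galg_ext \<sigma> v"
proof -
  let ?S = "Poly_Mapping.keys u \<union> Poly_Mapping.keys v"
  have "Poly_Mapping.keys (u + v) \<subseteq> ?S" by (rule keys_add)
  then show ?thesis
    by (simp add: galg_ext_superset[of ?S] lookup_add single_add sum.distrib)
qed

lemma galg_ext_0: "galg_ext \<sigma> 0 = 0"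
  by (simp add: galg_ext_def)

lemma galg_ext_sum: "galg_ext \<sigma> (\<Sum>i\<in>I. f i) = (\<Sum>i\<in>I. galg_ext \<sigma> (f i))"
  by (induction I rule: infinite_finite_induct) (simp_all add: galg_ext_0 galg_ext_add)

lemma galg_sum_single:
  "(\<Sum>g\<in>Poly_Mapping.keys u. Poly_Mapping.single g (Poly_Mapping.lookup u g)) = u"
  by (rule poly_mapping_eqI)
    (simp add: lookup_sum lookup_single when_def in_keys_iff)

text \<open>The extension of a group endomorphism is an algebra endomorphism.\<close>

lemma galg_ext_mult:
  assumes "\<And>g k. \<sigma> (g * k) = \<sigma> g * \<sigma> k"
  shows "galg_ext \<sigma> (u * v) = galg_ext \<sigma> u * galg_ext \<sigma> v"
proof -
  let ?s = "\<lambda>w g. Poly_Mapping.single g (Poly_Mapping.lookup w g)"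
  have "u * v = (\<Sum>g\<in>Poly_Mapping.keys u. ?s u g) * (\<Sum>k\<in>Poly_Mapping.keys v. ?s v k)"
    by (simp only: galg_sum_single)
  also have "galg_ext \<sigma> \<dots> =
      (\<Sum>g\<in>Poly_Mapping.keys u. \<Sum>k\<in>Poly_Mapping.keys v.
        Poly_Mapping.single (\<sigma> g) (Poly_Mapping.lookup u g) *
        Poly_Mapping.single (\<sigma> k) (Poly_Mapping.lookup v k))"
    by (simp add: sum_product galg_ext_sum mult_single galg_ext_single plus_promislow_def assms)
  also have "\<dots> = galg_ext \<sigma> u * galg_ext \<sigma> v"
    by (simp add: galg_ext_def sum_product)
  finally show ?thesis .
qed


section \<open>The units\<close>

definition mu_h :: "nat \<Rightarrow> int \<Rightarrow> 'f::field galg" where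
  "mu_h d t = (1 - gel (pz powi (1 - 2 * t))) ^ (d - 2)"

definition mu_p :: "nat \<Rightarrow> int \<Rightarrow> 'f::field galg" where
  "mu_p d t = (1 + gel px) * (1 + gel py) * (gel (pz powi t) + gel (pz powi (1 - t))) * mu_h d t"

definition mu_q :: "nat \<Rightarrow> int \<Rightarrow> int \<Rightarrow> 'f::field galg" where
  "mu_q d t w = gel (pz powi w) *
    ((1 + gel px) * (gel (inverse px) + gel (inverse py)) +
     (1 + gel (inverse py)) * (1 + gel (pz powi (2 * t - 1)))) * mu_h d t"

definition mu_r :: "nat \<Rightarrow> int \<Rightarrow> int \<Rightarrow> 'f::field galg" where
  "mu_r d t w = gel (pz powi w) *
    ((1 + gel (inverse py)) * (gel px + gel py) * gel (pz powi t) +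
     (1 + gel px) * (gel (pz powi t) + gel (pz powi (1 - t)))) * mu_h d t"

definition mu_s :: "nat \<Rightarrow> int \<Rightarrow> 'f::field galg" where
  "mu_s d t = gel (pz powi (2 * t - 1)) +
    (4 + gel px + gel (inverse px) + gel py + gel (inverse py)) * mu_h d t"

definition murray_unit :: "nat \<Rightarrow> int \<Rightarrow> int \<Rightarrow> 'f::field galg" where
  "murray_unit d t w = mu_p d t + mu_q d t w * gel pa + mu_r d t w * gel pb + mu_s d t * gel pc"

end

theory Submission
  imports Defs
begin

text \<open>
  The element \<open>z\<close> commutes with \<open>x\<close> and \<open>y\<close> and is inverted by \<open>a\<close> and \<open>b\<close>. Hence \<open>\<sigma>\<close> fixes \<open>x\<close>
  and \<open>y\<close>, so it respects the relations, and it maps \<open>c\<close> to \<open>z\<^sup>-\<^sup>t c\<close> and \<open>z\<close> to \<open>z\<^sup>1\<^sup>-\<^sup>2\<^sup>t\<close>. The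
  formula for \<open>u\<close> is then obtained by moving all powers of \<open>z\<close> in \<open>z\<^sup>t \<sigma>(u\<^sub>0)\<close> to the left.
\<close>

section \<open>Inverses, cancellation and integer powers in the group\<close>

lemma promislow_inverse_mult: "inverse (g * k) = inverse k * inverse (g :: promislow)"
  using minus_add[of g k] by (simp add: plus_promislow_def uminus_promislow_def)

lemma promislow_inverse_inverse [simp]: "inverse (inverse g) = (g :: promislow)"
  using minus_minus[of g] by (simp add: uminus_promislow_def)

lemma promislow_inverse_1 [simp]: "inverse 1 = (1 :: promislow)"
  using promislow_left_inverse[of 1] by simp

text \<open>Cancellation is read off from the additive copy of the group structure, where
  \<open>+\<close> unfolds to \<open>*\<close>.\<close>

lemma promislow_left_cancel [simp]: "g * k = g * l \<longleftrightarrow> k = (l :: promislow)"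
  using add_left_cancel[of g k l] by (simp add: plus_promislow_def)

lemma promislow_right_cancel [simp]: "k * g = l * g \<longleftrightarrow> k = (l :: promislow)"
  using add_right_cancel[of k g l] by (simp add: plus_promislow_def)

lemmas promislow_inverse_cancel [simp] = promislow_left_inverse promislow_right_inverse

lemma promislow_inverse_cancel_assoc [simp]:
  "inverse g * (g * k) = (k :: promislow)" "g * (inverse g * k) = (k :: promislow)"
  by (simp_all flip: mult.assoc)

lemma promislow_inverse_unique: "g * k = 1 \<Longrightarrow> inverse g = (k :: promislow)"
  by (metis promislow_left_cancel promislow_right_inverse)

text \<open>The hypothesis says that conjugation by \<open>k\<close> takes \<open>g\<close> to
  \<open>l\<close>, so it takes inverse to inverse. Conjugation facts keep this form so that they
  can be used to move factors past \<open>k\<close>.\<close>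

lemma promislow_swap_inverse:
  fixes g k l :: promislow
  assumes "g * k = k * l"
  shows "inverse g * k = k * inverse l"
proof -
  have "inverse g * k * l = inverse g * (g * k)"
    by (simp only: assms mult.assoc)
  then have "inverse g * k * l * inverse l = k * inverse l"
    by simp
  then show ?thesis by (simp add: mult.assoc)
qed

lemma promislow_inverse_power: "inverse (g ^ n) = inverse (g :: promislow) ^ n"
  by (induction n) (simp_all add: promislow_inverse_mult flip: power_Suc2)

lemma promislow_powi_simps [simp]:
  "(g :: promislow) powi 0 = 1" "g powi 1 = g" "g powi (- 1) = inverse g"
  by (simp_all add: power_int_def)

lemma promislow_powi_minus: "g powi (- n) = inverse ((g :: promislow) powi n)"
  by (auto simp: power_int_def promislow_inverse_power)

lemma promislow_powi_inverse: "inverse g powi n = (g :: promislow) powi (- n)"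
  by (auto simp: power_int_def)

lemma promislow_powi_add_1: "g powi (n + 1) = (g :: promislow) powi n * g"
proof (cases "n \<ge> 0")
  case True
  then show ?thesis by (simp add: power_int_def nat_add_distrib power_Suc2 del: power_Suc)
next
  case False
  then obtain m where n: "n = - int (Suc m)"
    by (metis int_cases not_le of_nat_0_le_iff)
  \<comment> \<open>For \<open>m = 0\<close> the exponent \<open>n + 1\<close> is 0 and falls under
    the nonnegative branch of \<open>powi\<close>; hence the case split.\<close>
  have "g powi (n + 1) = inverse g ^ m"
    by (cases m) (simp_all add: n power_int_def nat_add_distrib)
  moreover have "g powi n = inverse g ^ Suc m"
    by (simp add: n power_int_def nat_add_distrib)
  ultimately show ?thesis
    by (simp add: power_Suc2 mult.assoc del: power_Suc)
qed

lemma promislow_powi_add: "g powi (m + n) = (g :: promislow) powi m * g powi n"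
proof (induction n rule: int_induct[where k = 0])
  case base
  show ?case by simp
next
  case (step1 i)
  then show ?case
    using promislow_powi_add_1[of g "m + i"] promislow_powi_add_1[of g i]
    by (simp add: add.assoc mult.assoc)
next
  case (step2 i)
  have "g powi (m + (i - 1)) * g = g powi m * g powi (i - 1) * g"
    using promislow_powi_add_1[of g "m + (i - 1)"] promislow_powi_add_1[of g "i - 1"] step2
    by (simp add: mult.assoc algebra_simps)
  then show ?case by simp
qed

lemma promislow_powi_swap:
  fixes g k l :: promislow
  assumes "g * k = k * l"
  shows "g powi n * k = k * l powi n"
proof -
  \<comment> \<open>General in \<open>g\<close> and \<open>l\<close>, because negative exponents
    need it for \<open>inverse g\<close> and \<open>inverse l\<close>.\<close>
  have pow: "g ^ m * k = k * l ^ m" if "g * k = k * l" for g l :: promislow and m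
  proof (induction m)
    case (Suc m)
    have "g ^ Suc m * k = g * (g ^ m * k)"
      by (simp add: mult.assoc)
    also have "\<dots> = g * k * l ^ m"
      by (simp add: Suc.IH mult.assoc)
    also have "\<dots> = k * l ^ Suc m"
      by (simp add: that mult.assoc)
    finally show ?case .
  qed simp
  show ?thesis
    by (simp add: power_int_def pow assms promislow_swap_inverse)
qed


section \<open>Conjugation in the group\<close>

lemma px_eq: "px = pa * pa" and py_eq: "py = pb * pb"
  by (simp_all add: px_def py_def power2_eq_square)

lemma px_pa: "px * pa = pa * px" and py_pb: "py * pb = pb * py"
  by (simp_all add: px_eq py_eq mult.assoc)

lemma px_pb: "px * pb = pb * inverse px"
proof -
  have "inverse pb * px * pb = inverse px"
    using promislow_relation_a
    by (simp add: px_def power_int_def promislow_inverse_power)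
  then have "pb * (inverse pb * px * pb) = pb * inverse px" by simp
  then show ?thesis by (simp add: mult.assoc)
qed

lemma py_pa: "py * pa = pa * inverse py"
proof -
  have "inverse pa * py * pa = inverse py"
    using promislow_relation_b
    by (simp add: py_def power_int_def promislow_inverse_power)
  then have "pa * (inverse pa * py * pa) = pa * inverse py" by simp
  then show ?thesis by (simp add: mult.assoc)
qed

text \<open>Conjugating by \<open>k\<close> twice inverts \<open>g\<close> twice.\<close>

lemma promislow_commute_square:
  fixes g k :: promislow
  assumes "g * k = k * inverse g"
  shows "g * (k * k) = k * k * g"
proof -
  have "g * (k * k) = k * (inverse g * k)"
    by (simp add: assms flip: mult.assoc)
  also have "\<dots> = k * k * g"
    using promislow_swap_inverse[OF assms] by (simp add: mult.assoc)
  finally show ?thesis .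
qed

lemma px_py: "px * py = py * px"
  unfolding py_eq by (rule promislow_commute_square[OF px_pb])

lemma pz_pa: "pz * pa = pa * inverse pz"
proof -
  have "pb * px = inverse px * pb"
    using promislow_swap_inverse[OF px_pb] by simp
  \<comment> \<open>The trailing factor \<open>g\<close> lets these identities rewrite inside
    right-nested products.\<close>
  then have bxb: "pb * (px * (pb * g)) = inverse px * (py * g)" for g
    by (simp add: py_eq flip: mult.assoc)
  have "pa * py = inverse py * pa"
    using promislow_swap_inverse[OF py_pa] by simp
  then have aya: "pa * (py * (pa * g)) = inverse py * (px * g)" for g
    by (simp add: px_eq flip: mult.assoc)
  have ax: "pa * (inverse px * g) = inverse px * (pa * g)" for g
    using promislow_swap_inverse[OF px_pa] by (simp flip: mult.assoc)
  have xy: "inverse px * (inverse py * (px * g)) = inverse py * g" for g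
  proof -
    have "inverse py * px = px * inverse py"
      by (rule promislow_swap_inverse) (simp add: px_py)
    then have "inverse py * (px * g) = px * (inverse py * g)"
      by (simp flip: mult.assoc)
    then show ?thesis by simp
  qed
  \<comment> \<open>It suffices that zaz = a. The word ababaabab contains bxb, which is x^-1 y; this
    exposes aya, which is y^-1 x, and the powers of x then cancel.\<close>
  have "pz * pa * pz = pa * (pb * (pa * (pb * (px * (pb * (pa * pb))))))"
    by (simp add: pz_def pc_def px_eq power2_eq_square mult.assoc)
  also have "\<dots> = pa * (pb * (inverse py * pb))"
    by (simp add: bxb aya ax xy)
  also have "\<dots> = pa"
    using promislow_swap_inverse[OF py_pb] by (simp add: py_eq promislow_inverse_mult mult.assoc)
  finally have "pz * pa * pz * inverse pz = pa * inverse pz" by simp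
  then show ?thesis by (simp add: mult.assoc)
qed

text \<open>Since z is the square of c = ab, it commutes with ab; moving z past a by
  \<open>pz_pa\<close> and cancelling a leaves the claim for b.\<close>

lemma pz_pb: "pz * pb = pb * inverse pz"
proof -
  have "pa * (inverse pz * pb) = pz * pa * pb"
    by (simp add: pz_pa mult.assoc)
  also have "\<dots> = pa * (pb * pz)"
    by (simp add: pz_def pc_def power2_eq_square mult.assoc)
  finally have "inverse pz * pb = pb * pz" by simp
  from promislow_swap_inverse[OF this] show ?thesis by simp
qed

text \<open>Each of a and b flips the sign of the exponent, so c, x and y, being products of two of
  them, preserve it. Oriented as rewrite rules that collect powers of z on the left.\<close>

lemma powi_pz_swap:
  "pa * pz powi n = pz powi (- n) * pa"
  "pb * pz powi n = pz powi (- n) * pb"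
  "pc * pz powi n = pz powi n * pc"
  "px * pz powi n = pz powi n * px"
  "py * pz powi n = pz powi n * py"
  "inverse px * pz powi n = pz powi n * inverse px"
  "inverse py * pz powi n = pz powi n * inverse py"
proof -
  show a: "pa * pz powi n = pz powi (- n) * pa" for n
    using promislow_powi_swap[OF pz_pa, of "- n"] by (simp add: promislow_powi_inverse)
  show b: "pb * pz powi n = pz powi (- n) * pb" for n
    using promislow_powi_swap[OF pz_pb, of "- n"] by (simp add: promislow_powi_inverse)
  have ab: "pa * (pz powi n * g) = pz powi (- n) * (pa * g)"
    "pb * (pz powi n * g) = pz powi (- n) * (pb * g)" for n g
    by (simp_all add: a b flip: mult.assoc)
  show "pc * pz powi n = pz powi n * pc"
    by (simp add: pc_def a b ab mult.assoc)
  show x: "px * pz powi n = pz powi n * px"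
    by (simp add: px_eq a ab mult.assoc)
  show y: "py * pz powi n = pz powi n * py"
    by (simp add: py_eq b ab mult.assoc)
  show "inverse px * pz powi n = pz powi n * inverse px"
    by (rule promislow_swap_inverse[OF x])
  show "inverse py * pz powi n = pz powi n * inverse py"
    by (rule promislow_swap_inverse[OF y])
qed

lemma powi_pz_swap_assoc:
  "pa * (pz powi n * g) = pz powi (- n) * (pa * g)"
  "pb * (pz powi n * g) = pz powi (- n) * (pb * g)"
  "pc * (pz powi n * g) = pz powi n * (pc * g)"
  by (simp_all add: powi_pz_swap flip: mult.assoc)


section \<open>Endomorphisms of the group\<close>

text \<open>Evaluation of words once images of the generators are chosen, as in the universal
  property of the free group.\<close>

definition word_value :: "('g \<Rightarrow> promislow) \<Rightarrow> 'g word \<Rightarrow> promislow" where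
  "word_value f v = prod_list (map (\<lambda>(g, e). if e then f g else inverse (f g)) v)"

lemma word_value_pres_eq:
  assumes "pres_eq R v w"
    and "\<And>v w. (v, w) \<in> R \<Longrightarrow> word_value f v = word_value f w"
  shows "word_value f v = word_value f w"
  using assms(1) by induction (auto simp: word_value_def intro: assms(2)[unfolded word_value_def])

text \<open>Von Dyck's theorem for this presentation: evaluation at \<open>g\<close> and
  \<open>k\<close> respects both relations, so it descends to the quotient.\<close>

lemma promislow_endomorphism_exists:
  assumes "inverse k * g\<^sup>2 * k = inverse (g\<^sup>2)" "inverse g * k\<^sup>2 * g = inverse (k\<^sup>2)"
  obtains \<sigma> :: "promislow \<Rightarrow> promislow"
  where "\<And>g k. \<sigma> (g * k) = \<sigma> g * \<sigma> k" "\<sigma> pa = g" "\<sigma> pb = k"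
proof
  define f where "f = (\<lambda>l. case l of A \<Rightarrow> g | B \<Rightarrow> k)"
  define \<sigma> where "\<sigma> = (\<lambda>m. word_value f (rep_promislow m))"
  have rel: "word_value f v = word_value f w" if "(v, w) \<in> promislow_rels" for v w
    using that assms
    by (auto simp: promislow_rels_def word_value_def f_def power2_eq_square
        promislow_inverse_mult mult.assoc)
  \<comment> \<open>The value does not depend on the representative chosen by
    \<open>rep_promislow\<close>.\<close>
  have \<sigma>: "\<sigma> (abs_promislow v) = word_value f v" for v
  proof -
    have "pres_eq promislow_rels (rep_promislow (abs_promislow v)) v"
      by (simp add: Quotient3_abs_rep[OF Quotient3_promislow] flip: promislow.abs_eq_iff)
    then show ?thesis
      unfolding \<sigma>_def by (rule word_value_pres_eq) (rule rel)
  qed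
  show "\<sigma> (m * n) = \<sigma> m * \<sigma> n" for m n
  proof -
    have "\<sigma> (abs_promislow v * abs_promislow w) = \<sigma> (abs_promislow v) * \<sigma> (abs_promislow w)" for v w
      by (simp add: times_promislow.abs_eq \<sigma> word_value_def)
    then show ?thesis
      by (metis Quotient3_abs_rep[OF Quotient3_promislow])
  qed
  show "\<sigma> pa = g" "\<sigma> pb = k"
    by (simp_all add: pa.abs_eq pb.abs_eq \<sigma> word_value_def f_def)
qed

lemma promislow_hom_1:
  assumes "\<And>g k. \<sigma> (g * k) = \<sigma> g * (\<sigma> k :: promislow)"
  shows "\<sigma> (1 :: promislow) = 1"
  using assms[of 1 1] by (metis mult.right_neutral promislow_left_cancel)

lemma promislow_hom_inverse:
  assumes "\<And>g k. \<sigma> (g * k) = \<sigma> g * (\<sigma> k :: promislow)"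
  shows "\<sigma> (inverse (g :: promislow)) = inverse (\<sigma> g)"
  using assms[of g "inverse g"] promislow_hom_1[of \<sigma>, OF assms]
  by (simp add: promislow_inverse_unique)


section \<open>The group algebra\<close>

lemma gel_mult: "gel g * gel k = (gel (g * k) :: 'f::field galg)"
  by (simp add: mult_single plus_promislow_def)

lemma gel_1: "gel 1 = (1 :: 'f::field galg)"
  by (simp flip: zero_promislow_def)

lemma galg_ext_1:
  assumes "\<And>g k. \<sigma> (g * k) = \<sigma> g * \<sigma> k"
  shows "galg_ext \<sigma> 1 = (1 :: 'f::field galg)"
  using galg_ext_single[of \<sigma> 1 "1::'f"] promislow_hom_1[of \<sigma>, OF assms] by (simp add: gel_1)

text \<open>Serves the constant 4 in \<open>mu_s\<close>.\<close>

lemma galg_ext_numeral: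
  assumes "\<And>g k. \<sigma> (g * k) = \<sigma> g * \<sigma> k"
  shows "galg_ext \<sigma> (numeral n) = (numeral n :: 'f::field galg)"
  by (induction n) (simp_all only: numeral.simps galg_ext_add galg_ext_1[OF assms])

lemma galg_ext_diff: "galg_ext \<sigma> (u - v) = galg_ext \<sigma> u - galg_ext \<sigma> (v :: 'f::field galg)"
  using galg_ext_add[of \<sigma> "u - v" v] by (simp add: algebra_simps)

lemma galg_ext_power:
  assumes "\<And>g k. \<sigma> (g * k) = \<sigma> g * \<sigma> k"
  shows "galg_ext \<sigma> (u ^ n) = galg_ext \<sigma> (u :: 'f::field galg) ^ n"
  by (induction n) (simp_all add: galg_ext_mult[OF assms] galg_ext_1[OF assms])

section \<open>Collecting powers of z on the left in the group algebra\<close>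

lemma gel_powi_mult:
  "gel (pz powi m) * gel (pz powi n) = (gel (pz powi (m + n)) :: 'f::field galg)"
  by (simp add: gel_mult promislow_powi_add)

text \<open>\<open>mu_h\<close> is a power of an element built from powers of z, all of which
  commute.\<close>

lemma mu_h_swap: "mu_h d t * gel (pz powi n) = gel (pz powi n) * (mu_h d t :: 'f::field galg)"
proof -
  let ?z = "1 - gel (pz powi (1 - 2 * t)) :: 'f galg"
  have "?z * gel (pz powi n) = gel (pz powi n) * ?z"
    by (simp add: left_diff_distrib right_diff_distrib gel_powi_mult add.commute)
  then have "gel (pz powi n) * ?z ^ m = ?z ^ m * gel (pz powi n)" for m
    by (simp add: power_commuting_commutes)
  then show ?thesis by (simp add: mu_h_def)
qed

lemma gel_powi_swap:
  "gel px * gel (pz powi n) = gel (pz powi n) * (gel px :: 'f::field galg)"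
  "gel py * gel (pz powi n) = gel (pz powi n) * (gel py :: 'f galg)"
  "gel (inverse px) * gel (pz powi n) = gel (pz powi n) * (gel (inverse px) :: 'f galg)"
  "gel (inverse py) * gel (pz powi n) = gel (pz powi n) * (gel (inverse py) :: 'f galg)"
  by (simp_all add: gel_mult powi_pz_swap)

lemma numeral_gel_swap:
  "numeral k * gel g = gel g * (numeral k :: 'f::field galg)"
  by (induction k) (simp_all only: numeral.simps distrib_left distrib_right mult_1_left mult_1_right)

lemmas gel_powi_left = gel_powi_mult gel_powi_swap mu_h_swap numeral_gel_swap

text \<open>Companions of \<open>gel_powi_left\<close> for right-nested products; together they
  normalise without commutativity of the algebra.\<close>

lemma gel_powi_left_assoc:
  fixes v :: "'f::field galg"
  shows "gel (pz powi m) * (gel (pz powi n) * v) = gel (pz powi (m + n)) * v"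
    "gel px * (gel (pz powi n) * v) = gel (pz powi n) * (gel px * v)"
    "gel py * (gel (pz powi n) * v) = gel (pz powi n) * (gel py * v)"
    "gel (inverse px) * (gel (pz powi n) * v) = gel (pz powi n) * (gel (inverse px) * v)"
    "gel (inverse py) * (gel (pz powi n) * v) = gel (pz powi n) * (gel (inverse py) * v)"
    "mu_h d t * (gel (pz powi n) * v) = gel (pz powi n) * (mu_h d t * v)"
    "numeral k * (gel (pz powi n) * v) = gel (pz powi n) * (numeral k * v)"
  by (simp_all add: gel_powi_left flip: mult.assoc)

theorem proposition2:
  fixes d :: nat and t w :: int
  assumes "prime d" and "card (UNIV :: 'f::field set) = d"
  shows "\<exists>\<sigma> :: promislow \<Rightarrow> promislow.
    (\<forall>g k. \<sigma> (g * k) = \<sigma> g * \<sigma> k) \<and>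
    \<sigma> pa = pz powi w * pz powi (- t) * pa \<and>
    \<sigma> pb = pz powi w * pb \<and>
    (murray_unit d t w :: 'f galg) = gel (pz powi t) * galg_ext \<sigma> (murray_unit d 0 0)"
proof -
  let ?a = "pz powi w * pz powi (- t) * pa" and ?b = "pz powi w * pb"
  have z_assoc: "pz powi m * (pz powi n * g) = pz powi (m + n) * g" for m n g
    by (simp add: promislow_powi_add mult.assoc)
  note z_simps = mult.assoc powi_pz_swap powi_pz_swap_assoc z_assoc
  \<comment> \<open>Moving a or b past the power of z in front inverts that power, so it cancels in
    the square.\<close>
  have a2: "?a\<^sup>2 = px" and b2: "?b\<^sup>2 = py"
    by (simp_all add: px_eq py_eq power2_eq_square z_simps)
  have z_left: "px * (pz powi n * g) = pz powi n * (px * g)"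
    "py * (pz powi n * g) = pz powi n * (py * g)" for n g
    by (simp_all add: powi_pz_swap flip: mult.assoc)
  have conj: "inverse k * g * k = inverse g" if "g * k = k * inverse g" for g k :: promislow
    by (simp add: that mult.assoc)
  \<comment> \<open>With the squares unchanged, the relations for the new images only need z to
    commute with x and y.\<close>
  have "px * ?b = ?b * inverse px" "py * ?a = ?a * inverse py"
    by (simp_all add: mult.assoc z_left px_pb py_pa)
  then have "inverse ?b * ?a\<^sup>2 * ?b = inverse (?a\<^sup>2)" "inverse ?a * ?b\<^sup>2 * ?a = inverse (?b\<^sup>2)"
    unfolding a2 b2 by (blast intro: conj)+
  then obtain \<sigma> :: "promislow \<Rightarrow> promislow"
    where hom: "\<And>g k. \<sigma> (g * k) = \<sigma> g * \<sigma> k" and a: "\<sigma> pa = ?a" and b: "\<sigma> pb = ?b"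
    using promislow_endomorphism_exists by metis
  have x: "\<sigma> px = px" and y: "\<sigma> py = py"
    using a2 b2 by (simp_all add: px_eq py_eq hom a b power2_eq_square)
  \<comment> \<open>Moving a past z^w turns it into z^-w, which cancels the z^w contributed by the
    image of a.\<close>
  have c: "\<sigma> pc = pz powi (- t) * pc"
    by (simp add: pc_def hom a b z_simps)
  have "\<sigma> (pc * pc) = pz powi (- 2 * t) * (pc * pc)"
    by (simp add: hom c z_simps)
  moreover have "pc * pc = pz" by (simp add: pz_def power2_eq_square)
  ultimately have "\<sigma> pz = pz powi (- 2 * t) * pz" by simp
  then have z: "\<sigma> pz = pz powi (1 - 2 * t)"
    using promislow_powi_add_1[of pz "- 2 * t"] by (simp add: algebra_simps)
  have z': "\<sigma> (inverse pz) = pz powi (2 * t - 1)"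
    using promislow_powi_minus[of pz "1 - 2 * t"] by (simp add: promislow_hom_inverse[OF hom] z)
  note ext = galg_ext_mult[OF hom] galg_ext_add galg_ext_diff galg_ext_1[OF hom]
    galg_ext_numeral[OF hom] galg_ext_power[OF hom] galg_ext_single
  have h: "galg_ext \<sigma> (mu_h d 0) = (mu_h d t :: 'f galg)"
    by (simp add: mu_h_def ext z)
  have x': "\<sigma> (inverse px) = inverse px" and y': "\<sigma> (inverse py) = inverse py"
    by (simp_all add: promislow_hom_inverse[OF hom] x y)
  have gel_a: "gel (\<sigma> pa) = (gel (pz powi (w - t)) * gel pa :: 'f galg)"
    and gel_b: "gel (\<sigma> pb) = (gel (pz powi w) * gel pb :: 'f galg)"
    and gel_c: "gel (\<sigma> pc) = (gel (pz powi (- t)) * gel pc :: 'f galg)"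
    by (simp_all add: a b c gel_mult flip: promislow_powi_add)
  note push = distrib_left distrib_right mult.assoc gel_powi_left gel_powi_left_assoc
  let ?Z = "gel (pz powi t) :: 'f galg"
  \<comment> \<open>Here z^t (1 + z^(1-2t)) = z^t + z^(1-t).\<close>
  have P: "mu_p d t = ?Z * galg_ext \<sigma> (mu_p d 0 :: 'f galg)"
    by (simp add: mu_p_def ext h x y z push gel_1)
  \<comment> \<open>The images of a, b and c carry z^(w-t), z^w and z^-t. With the outer z^t these
    become z^w for \<open>mu_q\<close>, z^w z^t for \<open>mu_r\<close> and 1 for
    \<open>mu_s\<close>.\<close>
  have Q: "mu_q d t w * gel pa = ?Z * galg_ext \<sigma> (mu_q d 0 0 * gel pa :: 'f galg)"
    by (simp add: mu_q_def ext h x y x' y' z z' gel_a push gel_1 algebra_simps)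
  have R: "mu_r d t w * gel pb = ?Z * galg_ext \<sigma> (mu_r d 0 0 * gel pb :: 'f galg)"
    by (simp add: mu_r_def ext h x y x' y' z gel_b push gel_1 algebra_simps)
  have S: "mu_s d t * gel pc = ?Z * galg_ext \<sigma> (mu_s d 0 * gel pc :: 'f galg)"
    by (simp add: mu_s_def ext h x y x' y' z' gel_c push gel_1)
  have "murray_unit d t w = ?Z * galg_ext \<sigma> (murray_unit d 0 0)"
    by (simp only: murray_unit_def P Q R S galg_ext_add distrib_left)
  with hom a b show ?thesis by blast
qed

end
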